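(* (i) Every solution $(u^{\varepsilon,n})_{n\ge0}\subset X_N$ of the Crank-Nicolson finite difference (CNFD) scheme $$\delta_{t}^{2}u^{\varepsilon,n}_{j}-\frac{1}{2}\delta_{x}^{2}(u^{\varepsilon,n+1}_{j}+u^{\varepsilon,n-1}_{j})+\frac{1}{2}(u^{\varepsilon,n+1}_{j}+u^{\varepsilon,n-1}_{j})+G_{\varepsilon}(u^{\varepsilon,n+1}_{j},u^{\varepsilon,n-1}_{j})=0,\quad n\geq1,$$ satisfies the discrete energy conservation law $$E^{\varepsilon,n}:=\|\delta_{t}^{+}u^{\varepsilon,n}\|^{2}_{l^{2}}+\frac{1}{2}\left(\|\delta_{x}^{+}u^{\varepsilon,n+1}\|^{2}_{l^{2}}+\|\delta_{x}^{+}u^{\varepsilon,n}\|^{2}_{l^{2}}\right)+\frac{1}{2}\left(\|u^{\varepsilon,n+1}\|^{2}_{l^{2}}+\|u^{\varepsilon,n}\|^{2}_{l^{2}}\right)+\frac{h}{2}\sum_{j=0}^{N-1}\left[F_{\varepsilon}((u^{\varepsilon,n+1}_{j})^{2})+F_{\varepsilon}((u^{\varepsilon,n}_{j})^{2})\right]\equiv E^{\varepsilon,0},\quad n=0,1,2,\ldots$$ (ii) Every solution $(u^{\varepsilon,n})_{n\ge0}\subset X_N$ of the semi-implicit energy conservative finite difference (SIEFD) scheme $$\delta_{t}^{2}u^{\varepsilon,n}_{j}-\delta_{x}^{2}u^{\varepsilon,n}_{j}+\frac{1}{2}(u^{\varepsilon,n+1}_{j}+u^{\varepsilon,n-1}_{j})+G_{\varepsilon}(u^{\varepsilon,n+1}_{j},u^{\varepsilon,n-1}_{j})=0,\quad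 n\geq1,$$ satisfies $$\widetilde{E}^{\varepsilon,n}:=\|\delta_{t}^{+}u^{\varepsilon,n}\|^{2}_{l^{2}}+h\sum_{j=0}^{N-1}(\delta_{x}^{+}u^{\varepsilon,n+1}_{j})(\delta_{x}^{+}u^{\varepsilon,n}_{j})+\frac{1}{2}\left(\|u^{\varepsilon,n+1}\|^{2}_{l^{2}}+\|u^{\varepsilon,n}\|^{2}_{l^{2}}\right)+\frac{h}{2}\sum_{j=0}^{N-1}\left[F_{\varepsilon}((u^{\varepsilon,n+1}_{j})^{2})+F_{\varepsilon}((u^{\varepsilon,n}_{j})^{2})\right]\equiv\widetilde{E}^{\varepsilon,0},\quad n=0,1,2,\ldots$$
   Context: Let $\tau>0$ be the time step, $N$ a positive integer, $h=\frac{b-a}{N}$ the mesh size on an interval $(a,b)$, and $0<\varepsilon\ll1$. $X_N=\{u=(u_0,\ldots,u_N)^{\mathrm T}\in\mathbb{R}^{N+1}: u_0=u_N\}$, with periodic conventions $u_{-1}=u_{N-1}$, $u_{N+1}=u_1$; the schemes hold for all $j\in\{0,\ldots,N\}$. Difference operators: $\delta_t^{+}u_j^n=\frac{u_j^{n+1}-u_j^n}{\tau}$, $\delta_t^2u_j^n=\frac{u_j^{n+1}-2u_j^n+u_j^{n-1}}{\tau^2}$, $\delta_x^{+}u_j^n=\frac{u_{j+1}^n-u_j^n}{h}$, $\delta_x^2u_j^n=\frac{u_{j+1}^n-2u_j^n+u_{j-1}^n}{h^2}$. Norms: $\|u\|_{l^2}^2=h\sum_{j=0}^{N-1}|u_j|^2$,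 $\|\delta_x^+u\|_{l^2}^2=h\sum_{j=0}^{N-1}|\delta_x^+u_j|^2$. Nonlinearity: $f_\varepsilon(\rho)=\ln(\varepsilon^2+\rho)$ and $F_\varepsilon(\rho)=\int_0^\rho f_\varepsilon(s)\,\mathrm{d}s=\rho\ln(\varepsilon^2+\rho)+\varepsilon^2\ln(1+\frac{\rho}{\varepsilon^2})-\rho$ for $\rho\ge0$, and for $z_1,z_2\in\mathbb{R}$ $$G_\varepsilon(z_1,z_2)=\int_0^1 f_\varepsilon(\theta z_1^2+(1-\theta)z_2^2)\,\mathrm{d}\theta\cdot\frac{z_1+z_2}{2}$$ (which equals $\frac{F_\varepsilon(z_1^2)-F_\varepsilon(z_2^2)}{z_1^2-z_2^2}\cdot\frac{z_1+z_2}{2}$ when $z_1^2\ne z_2^2$). *)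

theory Defs
  imports "HOL-Analysis.Analysis"
begin

text \<open>
  A grid function is a map \<open>int \<Rightarrow> real\<close> of which only the entries with index \<open>-1, \<dots>, N+1\<close>
  matter: \<open>0, \<dots>, N\<close> are the components of the vector in $R^{N+1}$, while \<open>-1\<close> and \<open>N+1\<close>
  are the ghost entries, whose values the periodic conventions prescribe.  A sequence
  \<open>u :: nat \<Rightarrow> int \<Rightarrow> real\<close> of grid functions has \<open>u n j\<close> as its value at time level \<open>n\<close>
  and grid index \<open>j\<close>.
\<close>

definition grid_space :: "nat \<Rightarrow> (int \<Rightarrow> real) set" where
  "grid_space N = {v. v 0 = v (int N) \<and> v (-1) = v (int N - 1) \<and> v (int N + 1) = v 1}"

definition dt_plus :: "real \<Rightarrow> (nat \<Rightarrow> int \<Rightarrow> real) \<Rightarrow> nat \<Rightarrow> int \<Rightarrow> real" where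
  "dt_plus \<tau> u n j = (u (n + 1) j - u n j) / \<tau>"

text \<open>Used for \<open>n \<ge> 1\<close> only, so the subtraction on \<open>nat\<close> does not truncate.\<close>

definition dt2 :: "real \<Rightarrow> (nat \<Rightarrow> int \<Rightarrow> real) \<Rightarrow> nat \<Rightarrow> int \<Rightarrow> real" where
  "dt2 \<tau> u n j = (u (n + 1) j - 2 * u n j + u (n - 1) j) / \<tau>\<^sup>2"

definition dx_plus :: "real \<Rightarrow> (int \<Rightarrow> real) \<Rightarrow> int \<Rightarrow> real" where
  "dx_plus h v j = (v (j + 1) - v j) / h"

definition dx2 :: "real \<Rightarrow> (int \<Rightarrow> real) \<Rightarrow> int \<Rightarrow> real" where
  "dx2 h v j = (v (j + 1) - 2 * v j + v (j - 1)) / h\<^sup>2"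

definition l2_norm :: "real \<Rightarrow> nat \<Rightarrow> (int \<Rightarrow> real) \<Rightarrow> real" where
  "l2_norm h N v = sqrt (h * (\<Sum>j = 0..<int N. \<bar>v j\<bar>\<^sup>2))"

definition f_reg :: "real \<Rightarrow> real \<Rightarrow> real" where
  "f_reg \<epsilon> \<rho> = ln (\<epsilon>\<^sup>2 + \<rho>)"

text \<open>Meant for \<open>\<rho> \<ge> 0\<close>; for \<open>\<rho> < 0\<close> the interval is empty and the value is 0.\<close>

definition F_reg :: "real \<Rightarrow> real \<Rightarrow> real" where
  "F_reg \<epsilon> \<rho> = integral {0..\<rho>} (f_reg \<epsilon>)"

definition G_reg :: "real \<Rightarrow> real \<Rightarrow> real \<Rightarrow> real" where
  "G_reg \<epsilon> z1 z2 =
     integral {0..1} (\<lambda>\<theta>. f_reg \<epsilon> (\<theta> * z1\<^sup>2 + (1 - \<theta>) * z2\<^sup>2)) * ((z1 + z2) / 2)"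

definition CNFD_solution ::
    "real \<Rightarrow> real \<Rightarrow> nat \<Rightarrow> real \<Rightarrow> (nat \<Rightarrow> int \<Rightarrow> real) \<Rightarrow> bool" where
  "CNFD_solution \<tau> h N \<epsilon> u \<longleftrightarrow>
     (\<forall>n. u n \<in> grid_space N) \<and>
     (\<forall>n\<ge>1. \<forall>j\<in>{0..int N}.
        dt2 \<tau> u n j
        - 1 / 2 * dx2 h (\<lambda>i. u (n + 1) i + u (n - 1) i) j
        + 1 / 2 * (u (n + 1) j + u (n - 1) j)
        + G_reg \<epsilon> (u (n + 1) j) (u (n - 1) j) = 0)"

definition SIEFD_solution ::
    "real \<Rightarrow> real \<Rightarrow> nat \<Rightarrow> real \<Rightarrow> (nat \<Rightarrow> int \<Rightarrow> real) \<Rightarrow> bool" where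
  "SIEFD_solution \<tau> h N \<epsilon> u \<longleftrightarrow>
     (\<forall>n. u n \<in> grid_space N) \<and>
     (\<forall>n\<ge>1. \<forall>j\<in>{0..int N}.
        dt2 \<tau> u n j
        - dx2 h (u n) j
        + 1 / 2 * (u (n + 1) j + u (n - 1) j)
        + G_reg \<epsilon> (u (n + 1) j) (u (n - 1) j) = 0)"

definition CNFD_energy ::
    "real \<Rightarrow> real \<Rightarrow> nat \<Rightarrow> real \<Rightarrow> (nat \<Rightarrow> int \<Rightarrow> real) \<Rightarrow> nat \<Rightarrow> real" where
  "CNFD_energy \<tau> h N \<epsilon> u n =
     (l2_norm h N (dt_plus \<tau> u n))\<^sup>2
     + 1 / 2 * ((l2_norm h N (dx_plus h (u (n + 1))))\<^sup>2 + (l2_norm h N (dx_plus h (u n)))\<^sup>2)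
     + 1 / 2 * ((l2_norm h N (u (n + 1)))\<^sup>2 + (l2_norm h N (u n))\<^sup>2)
     + h / 2 * (\<Sum>j = 0..<int N. F_reg \<epsilon> ((u (n + 1) j)\<^sup>2) + F_reg \<epsilon> ((u n j)\<^sup>2))"

definition SIEFD_energy ::
    "real \<Rightarrow> real \<Rightarrow> nat \<Rightarrow> real \<Rightarrow> (nat \<Rightarrow> int \<Rightarrow> real) \<Rightarrow> nat \<Rightarrow> real" where
  "SIEFD_energy \<tau> h N \<epsilon> u n =
     (l2_norm h N (dt_plus \<tau> u n))\<^sup>2
     + h * (\<Sum>j = 0..<int N. dx_plus h (u (n + 1)) j * dx_plus h (u n) j)
     + 1 / 2 * ((l2_norm h N (u (n + 1)))\<^sup>2 + (l2_norm h N (u n))\<^sup>2)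
     + h / 2 * (\<Sum>j = 0..<int N. F_reg \<epsilon> ((u (n + 1) j)\<^sup>2) + F_reg \<epsilon> ((u n j)\<^sup>2))"

end

theory Submission
  imports Defs
begin

text \<open>
  Both schemes have the form
  \<open>\<delta>\<^sub>t\<^sup>2 u - \<delta>\<^sub>x\<^sup>2 w + (u\<^sup>n\<^sup>+\<^sup>1 + u\<^sup>n\<^sup>-\<^sup>1) / 2 + G\<^sub>\<epsilon>(u\<^sup>n\<^sup>+\<^sup>1, u\<^sup>n\<^sup>-\<^sup>1) = 0\<close>, where \<open>w\<close> is the mean of
  \<open>u\<^sup>n\<^sup>+\<^sup>1\<close> and \<open>u\<^sup>n\<^sup>-\<^sup>1\<close> for CNFD and \<open>w = u\<^sup>n\<close> for SIEFD.  The discrete counterpart of testing a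
  wave equation with the time derivative is to multiply by \<open>h (u\<^sup>n\<^sup>+\<^sup>1 - u\<^sup>n\<^sup>-\<^sup>1)\<close> and to sum over
  one period; every term then becomes a difference between two consecutive time levels.
  The terms in \<open>\<delta>\<^sub>t\<^sup>2\<close> and in the mean of \<open>u\<close> do so because products of a sum with a difference
  are differences of squares.  The term in \<open>\<delta>\<^sub>x\<^sup>2\<close> is summed by parts without boundary terms,
  by periodicity (\<open>sum_by_parts_dx2\<close>).  For the nonlinear term, \<open>G\<^sub>\<epsilon>\<close> is designed as a discrete
  gradient: the average of \<open>f\<^sub>\<epsilon>\<close> over a segment, times its signed length, is the
  increment of the antiderivative \<open>F\<^sub>\<epsilon>\<close> (\<open>G_reg_mult_diff\<close>).
  The resulting balance (\<open>energy_balance\<close>) is common to both schemes; they differ only in how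
  the inner product of \<open>\<delta>\<^sub>x\<^sup>+ w\<close> with \<open>\<delta>\<^sub>x\<^sup>+ (u\<^sup>n\<^sup>+\<^sup>1 - u\<^sup>n\<^sup>-\<^sup>1)\<close> telescopes in time.
\<close>

text \<open>
  The chain rule for an antiderivative along the segment from \<open>B\<close> to \<open>A\<close>.  All derivatives
  are taken within the interval of continuity, so an end point of the segment may be an
  end point of that interval, as happens below when a grid value vanishes.
\<close>

lemma segment_average_times_length:
  fixes g :: "real \<Rightarrow> real"
  assumes g: "continuous_on {l..r} g" and A: "A \<in> {l..r}" and B: "B \<in> {l..r}"
  shows "(A - B) * integral {0..1} (\<lambda>\<theta>. g (\<theta> * A + (1 - \<theta>) * B))
         = integral {l..A} g - integral {l..B} g"
proof -
  define \<gamma> where "\<gamma> \<theta> = \<theta> * A + (1 - \<theta>) * B" for \<theta>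
  define P where "P x = integral {l..x} g" for x
  have \<gamma>_mem: "\<gamma> ` {0..1} \<subseteq> {l..r}"
  proof
    fix x assume "x \<in> \<gamma> ` {0..1}"
    then obtain \<theta> where "\<theta> \<in> {0..1}" and x: "x = \<theta> *\<^sub>R A + (1 - \<theta>) *\<^sub>R B"
      by (auto simp: \<gamma>_def)
    then show "x \<in> {l..r}"
      unfolding x using convexD[OF convex_real_interval(5) A B] by auto
  qed
  have "((P \<circ> \<gamma>) has_real_derivative g (\<gamma> \<theta>) * (A - B)) (at \<theta> within {0..1})"
    if \<theta>: "\<theta> \<in> {0..1}" for \<theta>
  proof (rule DERIV_image_chain)
    show "(\<gamma> has_real_derivative (A - B)) (at \<theta> within {0..1})"
      unfolding \<gamma>_def by (auto intro!: derivative_eq_intros)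
    have "(P has_real_derivative g (\<gamma> \<theta>)) (at (\<gamma> \<theta>) within {l..r})"
      unfolding P_def by (rule integral_has_real_derivative[OF g]) (use \<gamma>_mem \<theta> in blast)
    then show "(P has_real_derivative g (\<gamma> \<theta>)) (at (\<gamma> \<theta>) within \<gamma> ` {0..1})"
      using \<gamma>_mem by (rule DERIV_subset)
  qed
  then have "((\<lambda>\<theta>. g (\<gamma> \<theta>) * (A - B)) has_integral (P \<circ> \<gamma>) 1 - (P \<circ> \<gamma>) 0) {0..1}"
    by (intro fundamental_theorem_of_calculus)
       (auto simp: has_real_derivative_iff_has_vector_derivative comp_def)
  then have "integral {0..1} (\<lambda>\<theta>. g (\<gamma> \<theta>) * (A - B)) = (P \<circ> \<gamma>) 1 - (P \<circ> \<gamma>) 0"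
    by (rule integral_unique)
  then have "(A - B) * integral {0..1} (\<lambda>\<theta>. g (\<gamma> \<theta>)) = (P \<circ> \<gamma>) 1 - (P \<circ> \<gamma>) 0"
    by (simp only: integral_mult_right mult.commute)
  also have "\<dots> = P A - P B"
    by (simp add: \<gamma>_def)
  finally have "(A - B) * integral {0..1} (\<lambda>\<theta>. g (\<gamma> \<theta>)) = P A - P B" .
  then show ?thesis
    unfolding \<gamma>_def P_def .
qed

lemma G_reg_mult_diff:
  assumes "\<epsilon> \<noteq> 0"
  shows "G_reg \<epsilon> z1 z2 * (z1 - z2) = (F_reg \<epsilon> (z1\<^sup>2) - F_reg \<epsilon> (z2\<^sup>2)) / 2"
proof -
  define I where "I = integral {0..1} (\<lambda>\<theta>. f_reg \<epsilon> (\<theta> * z1\<^sup>2 + (1 - \<theta>) * z2\<^sup>2))"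
  define r where "r = max (z1\<^sup>2) (z2\<^sup>2)"
  have pos: "\<epsilon>\<^sup>2 + x > 0" if "x \<ge> 0" for x
    using assms that by (simp add: add_pos_nonneg)
  have "continuous_on {0..r} (f_reg \<epsilon>)"
    unfolding f_reg_def using pos by (auto intro!: continuous_intros simp: less_imp_neq[symmetric])
  then have "(z1\<^sup>2 - z2\<^sup>2) * I = F_reg \<epsilon> (z1\<^sup>2) - F_reg \<epsilon> (z2\<^sup>2)"
    unfolding F_reg_def I_def by (rule segment_average_times_length) (auto simp: r_def)
  moreover have "G_reg \<epsilon> z1 z2 * (z1 - z2) = (z1\<^sup>2 - z2\<^sup>2) * I / 2"
    unfolding G_reg_def I_def[symmetric] by (simp add: power2_eq_square algebra_simps)
  ultimately show ?thesis
    by simp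
qed

lemma sum_int_telescope:
  fixes s :: "int \<Rightarrow> 'a::ab_group_add"
  shows "(\<Sum>j = 0..<int N. s (j + 1) - s j) = s (int N) - s 0"
proof (induction N)
  case (Suc N)
  have "{0..<int (Suc N)} = insert (int N) {0..<int N}"
    by auto
  then show ?case
    using Suc by (simp add: add.commute)
qed simp

text \<open>
  Abel summation leaves the difference of \<open>\<delta>\<^sub>x\<^sup>+ v\<^sub>j\<^sub>-\<^sub>1 w\<^sub>j\<close> between \<open>j = N\<close> and \<open>j = 0\<close>, which
  the periodic conventions for \<open>v\<^sub>-\<^sub>1\<close>, \<open>v\<^sub>N\<close> and \<open>w\<^sub>N\<close> cancel.
\<close>

lemma sum_by_parts_dx2:
  assumes "v \<in> grid_space N" and "w \<in> grid_space N"
  shows "(\<Sum>j = 0..<int N. dx2 h v j * w j) = - (\<Sum>j = 0..<int N. dx_plus h v j * dx_plus h w j)"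
proof -
  define s where "s j = dx_plus h v (j - 1) * w j / h" for j
  have "dx2 h v j * w j + dx_plus h v j * dx_plus h w j = s (j + 1) - s j" for j
    by (cases "h = 0") (auto simp: s_def dx2_def dx_plus_def power2_eq_square field_simps)
  then have "(\<Sum>j = 0..<int N. dx2 h v j * w j) + (\<Sum>j = 0..<int N. dx_plus h v j * dx_plus h w j)
      = s (int N) - s 0"
    by (simp add: sum_int_telescope flip: sum.distrib)
  also have "\<dots> = 0"
    using assms by (simp add: s_def dx_plus_def grid_space_def)
  finally show ?thesis
    by simp
qed

lemma l2_norm_power2:
  assumes "h \<ge> 0"
  shows "(l2_norm h N v)\<^sup>2 = h * (\<Sum>j = 0..<int N. (v j)\<^sup>2)"
  using assms by (simp add: l2_norm_def sum_nonneg)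

text \<open>
  The scheme at time level \<open>n + 1\<close> tested with \<open>h (u\<^sup>n\<^sup>+\<^sup>2 - u\<^sup>n)\<close>.  The grid function \<open>w\<close> to which
  \<open>\<delta>\<^sub>x\<^sup>2\<close> is applied is left arbitrary, so that one computation serves both schemes.
\<close>

lemma energy_balance:
  assumes h: "h \<ge> 0" and \<epsilon>: "\<epsilon> \<noteq> 0"
    and u: "\<And>n. u n \<in> grid_space N" and w: "w \<in> grid_space N"
    and scheme: "\<And>j. j \<in> {0..<int N} \<Longrightarrow>
      dt2 \<tau> u (n + 1) j - dx2 h w j + 1 / 2 * (u (n + 2) j + u n j)
      + G_reg \<epsilon> (u (n + 2) j) (u n j) = 0"
  shows "(l2_norm h N (dt_plus \<tau> u (n + 1)))\<^sup>2 - (l2_norm h N (dt_plus \<tau> u n))\<^sup>2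
    + h * (\<Sum>j = 0..<int N. dx_plus h w j * (dx_plus h (u (n + 2)) j - dx_plus h (u n) j))
    + 1 / 2 * ((l2_norm h N (u (n + 2)))\<^sup>2 - (l2_norm h N (u n))\<^sup>2)
    + h / 2 * (\<Sum>j = 0..<int N. F_reg \<epsilon> ((u (n + 2) j)\<^sup>2) - F_reg \<epsilon> ((u n j)\<^sup>2)) = 0"
proof -
  define d where "d j = u (n + 2) j - u n j" for j
  define Q where "Q j = (dt_plus \<tau> u (n + 1) j)\<^sup>2 - (dt_plus \<tau> u n j)\<^sup>2
    + 1 / 2 * ((u (n + 2) j)\<^sup>2 - (u n j)\<^sup>2)
    + 1 / 2 * (F_reg \<epsilon> ((u (n + 2) j)\<^sup>2) - F_reg \<epsilon> ((u n j)\<^sup>2))" for j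
  have d: "d \<in> grid_space N"
    using u[of n] u[of "n + 2"] by (auto simp: d_def grid_space_def)
  have dx_d: "dx_plus h d j = dx_plus h (u (n + 2)) j - dx_plus h (u n) j" for j
    by (simp add: d_def dx_plus_def flip: diff_divide_distrib)
  have tested: "Q j = dx2 h w j * d j" if j: "j \<in> {0..<int N}" for j
  proof -
    have kinetic: "dt2 \<tau> u (n + 1) j * d j = (dt_plus \<tau> u (n + 1) j)\<^sup>2 - (dt_plus \<tau> u n j)\<^sup>2"
      by (simp add: dt2_def dt_plus_def d_def power_divide flip: diff_divide_distrib)
         (simp add: power2_eq_square algebra_simps)
    have mass: "1 / 2 * (u (n + 2) j + u n j) * d j = 1 / 2 * ((u (n + 2) j)\<^sup>2 - (u n j)\<^sup>2)"
      by (simp add: d_def power2_eq_square field_simps)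
    have "(dt2 \<tau> u (n + 1) j - dx2 h w j + 1 / 2 * (u (n + 2) j + u n j)
      + G_reg \<epsilon> (u (n + 2) j) (u n j)) * d j = Q j - dx2 h w j * d j"
      using kinetic mass G_reg_mult_diff[OF \<epsilon>, of "u (n + 2) j" "u n j"]
      unfolding Q_def by (simp only: ring_distribs d_def) simp
    then show ?thesis
      using scheme[OF j] by simp
  qed
  have "(\<Sum>j = 0..<int N. Q j) = - (\<Sum>j = 0..<int N. dx_plus h w j * dx_plus h d j)"
    using tested sum_by_parts_dx2[OF w d] by simp
  then have "h * (\<Sum>j = 0..<int N. Q j) + h * (\<Sum>j = 0..<int N. dx_plus h w j * dx_plus h d j) = 0"
    by simp
  then show ?thesis
    by (simp add: Q_def dx_d l2_norm_power2[OF h] sum.distrib sum_subtractf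
        flip: sum_divide_distrib) (simp add: algebra_simps)
qed

lemma CNFD_energy_Suc:
  assumes h: "h \<ge> 0" and \<epsilon>: "\<epsilon> \<noteq> 0" and sol: "CNFD_solution \<tau> h N \<epsilon> u"
  shows "CNFD_energy \<tau> h N \<epsilon> u (Suc n) = CNFD_energy \<tau> h N \<epsilon> u n"
proof -
  define w where "w j = (u (n + 2) j + u n j) / 2" for j
  have u: "u n \<in> grid_space N" for n
    using sol by (simp add: CNFD_solution_def)
  have w: "w \<in> grid_space N"
    using u[of n] u[of "n + 2"] by (auto simp: w_def grid_space_def)
  have dx2_w: "dx2 h w j = 1 / 2 * dx2 h (\<lambda>i. u (n + 2) i + u n i) j" for j
    by (simp add: w_def dx2_def add_divide_distrib diff_divide_distrib)
  have scheme: "dt2 \<tau> u (n + 1) j - dx2 h w j + 1 / 2 * (u (n + 2) j + u n j)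
      + G_reg \<epsilon> (u (n + 2) j) (u n j) = 0" if "j \<in> {0..<int N}" for j
    using sol that unfolding CNFD_solution_def dx2_w by (auto dest: spec[of _ "n + 1"])
  have dx_w: "dx_plus h w j = (dx_plus h (u (n + 2)) j + dx_plus h (u n) j) / 2" for j
    by (simp add: w_def dx_plus_def add_divide_distrib diff_divide_distrib)
  have "dx_plus h w j * (dx_plus h (u (n + 2)) j - dx_plus h (u n) j)
      = 1 / 2 * ((dx_plus h (u (n + 2)) j)\<^sup>2 - (dx_plus h (u n) j)\<^sup>2)" for j
    unfolding dx_w by (simp add: power2_eq_square field_simps)
  then have elastic:
    "h * (\<Sum>j = 0..<int N. dx_plus h w j * (dx_plus h (u (n + 2)) j - dx_plus h (u n) j))
      = 1 / 2 * ((l2_norm h N (dx_plus h (u (n + 2))))\<^sup>2 - (l2_norm h N (dx_plus h (u n)))\<^sup>2)"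
    by (simp add: l2_norm_power2[OF h] sum_subtractf right_diff_distrib diff_divide_distrib
        flip: sum_divide_distrib)
  show ?thesis
    using energy_balance[OF h \<epsilon> u w scheme] unfolding elastic
    by (simp add: CNFD_energy_def sum.distrib sum_subtractf algebra_simps)
qed

lemma SIEFD_energy_Suc:
  assumes h: "h \<ge> 0" and \<epsilon>: "\<epsilon> \<noteq> 0" and sol: "SIEFD_solution \<tau> h N \<epsilon> u"
  shows "SIEFD_energy \<tau> h N \<epsilon> u (Suc n) = SIEFD_energy \<tau> h N \<epsilon> u n"
proof -
  have u: "u n \<in> grid_space N" for n
    using sol by (simp add: SIEFD_solution_def)
  have scheme: "dt2 \<tau> u (n + 1) j - dx2 h (u (n + 1)) j + 1 / 2 * (u (n + 2) j + u n j)
      + G_reg \<epsilon> (u (n + 2) j) (u n j) = 0" if "j \<in> {0..<int N}" for j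
    using sol that unfolding SIEFD_solution_def by (auto dest: spec[of _ "n + 1"])
  show ?thesis
    using energy_balance[OF h \<epsilon> u u scheme]
    by (simp add: SIEFD_energy_def sum.distrib sum_subtractf algebra_simps)
qed

theorem theorem3p1:
  fixes \<tau> a b h \<epsilon> :: real and N :: nat
  assumes "\<tau> > 0" and "a < b" and "N > 0" and "h = (b - a) / real N" and "\<epsilon> > 0"
  shows "(\<forall>u. CNFD_solution \<tau> h N \<epsilon> u \<longrightarrow>
            (\<forall>n. CNFD_energy \<tau> h N \<epsilon> u n = CNFD_energy \<tau> h N \<epsilon> u 0)) \<and>
         (\<forall>u. SIEFD_solution \<tau> h N \<epsilon> u \<longrightarrow>
            (\<forall>n. SIEFD_energy \<tau> h N \<epsilon> u n = SIEFD_energy \<tau> h N \<epsilon> u 0))"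
proof -
  have h: "h \<ge> 0"
    using assms by simp
  have \<epsilon>: "\<epsilon> \<noteq> 0"
    using assms by simp
  have "CNFD_energy \<tau> h N \<epsilon> u n = CNFD_energy \<tau> h N \<epsilon> u 0"
    if "CNFD_solution \<tau> h N \<epsilon> u" for u n
    by (induction n) (simp_all add: CNFD_energy_Suc[OF h \<epsilon> that])
  moreover have "SIEFD_energy \<tau> h N \<epsilon> u n = SIEFD_energy \<tau> h N \<epsilon> u 0"
    if "SIEFD_solution \<tau> h N \<epsilon> u" for u n
    by (induction n) (simp_all add: SIEFD_energy_Suc[OF h \<epsilon> that])
  ultimately show ?thesis
    by blast
qed

end
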